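(* Hold an $n$-entry table $R$ at fixed slots of a ring of period $P$, each entry in exactly one slot, read through one port (a fixed station), and run an $L$-step chase $j_{k+1}=f(R[j_k])$. Let $j_1$ be uniform on the table indices and each $j_{k+1}$ uniform on the table indices given $j_1,\dots,j_k$, the expectation being over the sequence. Then for any placement of the table and any mechanism, the time $T$ (in cycles) of the chase satisfies $$\mathbb{E}[T]\;\ge\;(L-1)\,\frac{P}{2}\Big(1-\frac1n\Big).$$
   Context: A ring of period $P$ is a cyclic array of $P$ slots advancing one position per cycle past a fixed station. An entry seated at a given slot can be read by the station only at cycles congruent to a fixed phase modulo $P$ determined by its slot; different entries occupy different slots, so have different phases. The reads of $R[j_1],R[j_2],\dots,R[j_L]$ are dependence-ordered: $R[j_{k+1}]$ is read only after $R[j_k]$ has been read. $T$ is the number of cycles elapsed over the $L$ reads. *)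

theory Defs
  imports "HOL-Probability.Probability"
begin

text \<open>
  The ring has slots \<open>0, \<dots>, P - 1\<close>. Slot \<open>s\<close> is at position \<open>(s + t) mod P\<close> in cycle \<open>t\<close>, and the
  station stands at the fixed position \<open>q\<close>. Hence slot \<open>s\<close> can be read exactly in the cycles
  congruent to its phase \<open>q - s\<close> modulo \<open>P\<close>.
\<close>

definition slot_position :: "nat \<Rightarrow> nat \<Rightarrow> nat \<Rightarrow> nat" where
  "slot_position P s t = (s + t) mod P"

definition readable :: "nat \<Rightarrow> nat \<Rightarrow> nat \<Rightarrow> nat \<Rightarrow> bool" where
  "readable P q s t \<longleftrightarrow> slot_position P s t = q"

definition placement :: "nat \<Rightarrow> nat \<Rightarrow> (nat \<Rightarrow> nat) \<Rightarrow> bool" where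
  "placement P n slot \<longleftrightarrow> slot ` {..<n} \<subseteq> {..<P} \<and> inj_on slot {..<n}"

text \<open>
  Steps are numbered \<open>1, \<dots>, L\<close>, table indices \<open>0, \<dots>, n - 1\<close>. The map \<open>f\<close> is indexed by the step:
  with one map for all steps a repeated index would determine its successor, so that the successor
  could not be uniform given the past.
\<close>

definition chase :: "nat \<Rightarrow> (nat \<Rightarrow> 'v) \<Rightarrow> (nat \<Rightarrow> 'v \<Rightarrow> nat) \<Rightarrow> (nat \<Rightarrow> nat) \<Rightarrow> bool" where
  "chase L R f j \<longleftrightarrow> (\<forall>k\<in>{1..<L}. j (Suc k) = f k (R (j k)))"

definition uniform_steps :: "'w measure \<Rightarrow> nat \<Rightarrow> nat \<Rightarrow> (nat \<Rightarrow> 'w \<Rightarrow> nat) \<Rightarrow> bool" where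
  "uniform_steps M n L J \<longleftrightarrow>
     (\<forall>k\<in>{1..L}. J k \<in> measurable M (count_space {..<n})) \<and>
     (\<forall>i<n. \<P>(\<omega> in M. J 1 \<omega> = i) = 1 / real n) \<and>
     (\<forall>k\<in>{1..<L}. \<forall>h. \<P>(\<omega> in M. \<forall>m\<in>{1..k}. J m \<omega> = h m) > 0 \<longrightarrow>
        (\<forall>i<n. \<P>(\<omega> in M. J (Suc k) \<omega> = i \<bar> \<forall>m\<in>{1..k}. J m \<omega> = h m) = 1 / real n))"

text \<open>
  Here \<open>t k\<close> is the cycle in which \<open>R[j k]\<close> is read. Nothing else restricts the mechanism; in
  particular the read times may depend on the whole index sequence and on further randomness.
\<close>

definition read_schedule ::
    "nat \<Rightarrow> nat \<Rightarrow> (nat \<Rightarrow> nat) \<Rightarrow> nat \<Rightarrow> (nat \<Rightarrow> nat) \<Rightarrow> (nat \<Rightarrow> nat) \<Rightarrow> bool" where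
  "read_schedule P q slot L j t \<longleftrightarrow>
     (\<forall>k\<in>{1..L}. readable P q (slot (j k)) (t k)) \<and>
     (\<forall>k\<in>{1..<L}. t k < t (Suc k))"

definition chase_time :: "nat \<Rightarrow> (nat \<Rightarrow> nat) \<Rightarrow> nat" where
  "chase_time L t = t L - t 1"

end

theory Submission imports Defs
begin

text \<open>
  Between consecutive reads of entries in slots \<open>a\<close> and \<open>b\<close> at least \<open>(a - b) mod P\<close> cycles pass.
  For \<open>a \<noteq> b\<close> the two directions add up to \<open>P\<close>, and consecutive indices form a uniform pair, so
  swapping the pair shows that a step takes at least \<open>P / 2\<close> times the probability \<open>1 - 1 / n\<close>
  of distinct indices on average.
\<close>

section \<open>Cyclic distances between slots and the duration of a single run\<close>

definition slot_gap :: "nat \<Rightarrow> nat \<Rightarrow> nat \<Rightarrow> nat" where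
  "slot_gap P a b = nat ((int a - int b) mod int P)"

text \<open>Both reads happen at position \<open>q\<close>, so \<open>a + s\<close> and
  \<open>b + u\<close> agree modulo \<open>P\<close>, which puts \<open>u - s\<close> in the residue
  class of \<open>a - b\<close>. The gap is the least nonnegative member of that class. The sign is
  \<open>a - b\<close> because the phase of a slot decreases as its number grows; the integers avoid
  truncation for \<open>a < b\<close>.\<close>

lemma slot_gap_le:
  assumes "readable P q a s" "readable P q b u" "s < u"
  shows "slot_gap P a b \<le> u - s"
proof -
  have "(int a + int s) mod int P = (int b + int u) mod int P"
    using assms(1,2) unfolding readable_def slot_position_def
    by (metis of_nat_add zmod_int)
  then have "int P dvd (int a + int s) - (int b + int u)"
    by (simp add: mod_eq_dvd_iff)
  then have "int P dvd (int a - int b) - (int u - int s)"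
    by (simp add: algebra_simps)
  then have "(int a - int b) mod int P = (int u - int s) mod int P"
    by (simp add: mod_eq_dvd_iff)
  also have "\<dots> \<le> int u - int s"
    using assms(3) by (intro zmod_le_nonneg_dividend) simp
  finally show ?thesis
    using assms(3) unfolding slot_gap_def by linarith
qed

lemma slot_gap_add_swap:
  assumes "a < P" "b < P" "a \<noteq> b"
  shows "slot_gap P a b + slot_gap P b a = P"
proof (cases "a < b")
  case True
  \<comment> \<open>Adding \<open>P\<close> brings the negative difference into the range from 0 to
    \<open>P - 1\<close>; \<open>mod_add_self2\<close> then removes the added period.\<close>
  have "(int a - int b + int P) mod int P = int a - int b + int P"
    using assms True by (intro mod_pos_pos_trivial) auto
  moreover have "(int b - int a) mod int P = int b - int a"
    using assms True by (intro mod_pos_pos_trivial) auto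
  ultimately show ?thesis using assms True unfolding slot_gap_def mod_add_self2 by linarith
next
  case False
  have "(int b - int a + int P) mod int P = int b - int a + int P"
    using assms False by (intro mod_pos_pos_trivial) auto
  moreover have "(int a - int b) mod int P = int a - int b"
    using assms False by (intro mod_pos_pos_trivial) auto
  ultimately show ?thesis using assms False unfolding slot_gap_def mod_add_self2 by linarith
qed

lemma sum_slot_gap:
  assumes "placement P n slot"
  shows "2 * (\<Sum>a<n. \<Sum>b<n. slot_gap P (slot a) (slot b)) = n * (n - 1) * P"
proof -
  let ?D = "\<lambda>a b. slot_gap P (slot a) (slot b)"
  have pair: "?D a b + ?D b a = (if a = b then 0 else P)" if "a < n" "b < n" for a b
  proof (cases "a = b")
    case True
    then show ?thesis by (simp add: slot_gap_def)
  next
    case False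
    then have "slot a < P" "slot b < P" "slot a \<noteq> slot b"
      using assms that unfolding placement_def inj_on_def by auto
    with False show ?thesis by (simp add: slot_gap_add_swap)
  qed
  have "2 * (\<Sum>a<n. \<Sum>b<n. ?D a b) = (\<Sum>a<n. \<Sum>b<n. ?D a b) + (\<Sum>a<n. \<Sum>b<n. ?D b a)"
    \<comment> \<open>The second copy of the double sum is transposed, so that each ordered pair
      meets its reverse termwise.\<close>
    by (subst (3) sum.swap) simp
  also have "\<dots> = (\<Sum>a<n. \<Sum>b<n. if a = b then 0 else P)"
    unfolding sum.distrib[symmetric] by (intro sum.cong) (simp_all add: pair)
  also have "\<dots> = (\<Sum>a<n. (n - 1) * P)"
  proof (intro sum.cong refl)
    fix a assume "a \<in> {..<n}"
    \<comment> \<open>Only the diagonal entry of row \<open>a\<close> vanishes; the other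
      \<open>n - 1\<close> entries equal \<open>P\<close>.\<close>
    then have "(\<Sum>b<n. if a = b then 0 else P) = (\<Sum>b\<in>{..<n} - {a}. P)"
      by (intro sum.mono_neutral_cong_right) auto
    with \<open>a \<in> {..<n}\<close> show "(\<Sum>b<n. if a = b then 0 else P) = (n - 1) * P" by simp
  qed
  finally show ?thesis by (simp add: mult.assoc)
qed

lemma sum_slot_gap_le_chase_time:
  assumes "read_schedule P q slot L j t" "L \<ge> 1"
  shows "(\<Sum>k\<in>{1..<L}. slot_gap P (slot (j k)) (slot (j (Suc k)))) \<le> chase_time L t"
proof -
  \<comment> \<open>Telescoping, with \<open>t 1\<close> kept on the left: this form shows
    \<open>t 1\<close> \<le> \<open>t L\<close> as well, so the natural subtraction in
    \<open>chase_time\<close> does not truncate.\<close>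
  have "t 1 + (\<Sum>k\<in>{1..<m}. slot_gap P (slot (j k)) (slot (j (Suc k)))) \<le> t m"
    if "1 \<le> m" "m \<le> L" for m
    using that
  proof (induction m rule: dec_induct)
    case base
    then show ?case by simp
  next
    case (step m)
    have "slot_gap P (slot (j m)) (slot (j (Suc m))) \<le> t (Suc m) - t m"
      using assms(1) step unfolding read_schedule_def by (intro slot_gap_le) auto
    moreover have "t m < t (Suc m)"
      using assms(1) step unfolding read_schedule_def by auto
    ultimately show ?case using step by simp
  qed
  from this[of L] assms(2) show ?thesis unfolding chase_time_def by simp
qed

section \<open>The joint law of consecutive indices and the mean gap\<close>

context prob_space
begin

lemma uniform_steps_sets:
  assumes "uniform_steps M n L J" "k \<in> {1..L}"
  shows "{\<omega> \<in> space M. J k \<omega> = i} \<in> events"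
proof -
  \<comment> \<open>For \<open>i\<close> \<ge> \<open>n\<close> the set \<open>{i}\<close> is not in
    the target space; the intersection makes it empty, which matches an event that never
    occurs.\<close>
  have "J k -` ({i} \<inter> {..<n}) \<inter> space M \<in> events"
    using assms unfolding uniform_steps_def by (intro measurable_sets) auto
  moreover have "J k -` ({i} \<inter> {..<n}) \<inter> space M = {\<omega> \<in> space M. J k \<omega> = i}"
    using assms measurable_space[of "J k" M "count_space {..<n}"]
    unfolding uniform_steps_def by auto
  ultimately show ?thesis by simp
qed

lemma uniform_steps_less:
  assumes "uniform_steps M n L J" "k \<in> {1..L}" "\<omega> \<in> space M"
  shows "J k \<omega> < n"
  using assms measurable_space[of "J k" M "count_space {..<n}"]
  unfolding uniform_steps_def by auto

text \<open>The product form of the conditional hypothesis. Unlike that hypothesis it also covers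
  histories of probability zero, where both sides vanish by monotonicity, so histories can be summed
  without case distinctions.\<close>

lemma uniform_steps_history:
  assumes "uniform_steps M n L J" "k \<in> {1..<L}" "b < n"
  shows "\<P>(\<omega> in M. J (Suc k) \<omega> = b \<and> (\<forall>m\<in>{1..k}. J m \<omega> = h m))
    = \<P>(\<omega> in M. \<forall>m\<in>{1..k}. J m \<omega> = h m) / n"
proof (cases "\<P>(\<omega> in M. \<forall>m\<in>{1..k}. J m \<omega> = h m) > 0")
  case True
  then have "\<P>(\<omega> in M. J (Suc k) \<omega> = b \<bar> \<forall>m\<in>{1..k}. J m \<omega> = h m) = 1 / n"
    using assms unfolding uniform_steps_def by blast
  with True show ?thesis unfolding cond_prob_def by (simp add: field_simps)
next
  case False
  then have zero: "\<P>(\<omega> in M. \<forall>m\<in>{1..k}. J m \<omega> = h m) = 0"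
    by (simp add: zero_less_measure_iff)
  have "{\<omega> \<in> space M. \<forall>m\<in>{1..k}. J m \<omega> = h m} \<in> events"
    using assms by (intro sets.sets_Collect_finite_All uniform_steps_sets) auto
  then have "\<P>(\<omega> in M. J (Suc k) \<omega> = b \<and> (\<forall>m\<in>{1..k}. J m \<omega> = h m))
      \<le> \<P>(\<omega> in M. \<forall>m\<in>{1..k}. J m \<omega> = h m)"
    by (intro finite_measure_mono) auto
  with zero show ?thesis by (simp add: measure_le_0_iff)
qed

text \<open>Coarsens the conditioning from the whole history to the last index: the event
  \<open>J k \<omega> = a\<close> splits into finitely many disjoint history events, and each passes
  on the same factor \<open>1 / n\<close>.\<close>

lemma uniform_steps_Suc:
  assumes U: "uniform_steps M n L J" and k: "k \<in> {1..<L}" and b: "b < n"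
  shows "\<P>(\<omega> in M. J k \<omega> = a \<and> J (Suc k) \<omega> = b) = \<P>(\<omega> in M. J k \<omega> = a) / n"
proof -
  \<comment> \<open>Extensional functions fix the values outside \<open>{1..k}\<close>, so each
    outcome has exactly one history in \<open>?H\<close>; with arbitrary functions uniqueness would
    fail.\<close>
  let ?H = "{h \<in> PiE {1..k} (\<lambda>_. {..<n}). h k = a}"
  let ?E = "\<lambda>h \<omega>. \<forall>m\<in>{1..k}. J m \<omega> = h m"
  have fin: "finite ?H"
    by (intro finite_subset[OF _ finite_PiE[of "{1..k}" "\<lambda>_. {..<n}"]]) auto
  have E: "{\<omega> \<in> space M. ?E h \<omega>} \<in> events" for h
    using U k by (intro sets.sets_Collect_finite_All uniform_steps_sets) auto
  have Jk: "{\<omega> \<in> space M. J k \<omega> = i} \<in> events" for i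
    using U k by (intro uniform_steps_sets) auto
  have JS: "{\<omega> \<in> space M. J (Suc k) \<omega> = i} \<in> events" for i
    using U k by (intro uniform_steps_sets) auto
  have uniq: "\<exists>!h\<in>?H. ?E h \<omega>" if "\<omega> \<in> space M" "J k \<omega> = a" for \<omega>
  proof (rule ex1I[of _ "restrict (\<lambda>m. J m \<omega>) {1..k}"])
    show "restrict (\<lambda>m. J m \<omega>) {1..k} \<in> ?H \<and> ?E (restrict (\<lambda>m. J m \<omega>) {1..k}) \<omega>"
      using that k uniform_steps_less[OF U] by (auto simp: PiE_iff)
    show "h = restrict (\<lambda>m. J m \<omega>) {1..k}" if "h \<in> ?H \<and> ?E h \<omega>" for h
      using that by (auto simp: PiE_iff extensional_def restrict_def fun_eq_iff)
  qed
  have "\<P>(\<omega> in M. J k \<omega> = a \<and> J (Suc k) \<omega> = b)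
      = (\<Sum>h\<in>?H. \<P>(\<omega> in M. J (Suc k) \<omega> = b \<and> ?E h \<omega>))"
  proof (rule prob_sum[OF fin])
    show "AE \<omega> in M. (\<forall>h\<in>?H. J (Suc k) \<omega> = b \<and> ?E h \<omega> \<longrightarrow> J k \<omega> = a \<and> J (Suc k) \<omega> = b) \<and>
        (J k \<omega> = a \<and> J (Suc k) \<omega> = b \<longrightarrow> (\<exists>!h\<in>?H. J (Suc k) \<omega> = b \<and> ?E h \<omega>))"
    proof (rule AE_I2, intro conjI impI ballI)
      fix \<omega> h assume "h \<in> ?H" "J (Suc k) \<omega> = b \<and> ?E h \<omega>"
      then show "J k \<omega> = a" "J (Suc k) \<omega> = b" using k by auto
    next
      fix \<omega> assume "\<omega> \<in> space M" "J k \<omega> = a \<and> J (Suc k) \<omega> = b"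
      then show "\<exists>!h\<in>?H. J (Suc k) \<omega> = b \<and> ?E h \<omega>" using uniq by simp
    qed
    show "{\<omega> \<in> space M. J k \<omega> = a \<and> J (Suc k) \<omega> = b} \<in> events"
      by (intro sets.sets_Collect_conj Jk JS)
    show "{\<omega> \<in> space M. J (Suc k) \<omega> = b \<and> ?E h \<omega>} \<in> events" for h
      by (intro sets.sets_Collect_conj JS E)
  qed
  also have "\<dots> = (\<Sum>h\<in>?H. \<P>(\<omega> in M. ?E h \<omega>) / n)"
    using uniform_steps_history[OF U k b] by simp
  also have "\<dots> = (\<Sum>h\<in>?H. \<P>(\<omega> in M. ?E h \<omega>)) / n"
    by (simp add: sum_divide_distrib)
  also have "(\<Sum>h\<in>?H. \<P>(\<omega> in M. ?E h \<omega>)) = \<P>(\<omega> in M. J k \<omega> = a)"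
  proof (rule prob_sum[OF fin, symmetric])
    show "AE \<omega> in M. (\<forall>h\<in>?H. ?E h \<omega> \<longrightarrow> J k \<omega> = a) \<and> (J k \<omega> = a \<longrightarrow> (\<exists>!h\<in>?H. ?E h \<omega>))"
      using k uniq by (intro AE_I2) auto
  qed (use Jk E in auto)
  finally show ?thesis .
qed

text \<open>By induction, summing the joint probabilities over the \<open>n\<close> values of the
  previous index. Together with \<open>uniform_steps_Suc\<close> this gives each consecutive pair
  probability \<open>1 / n / n\<close>.\<close>

lemma uniform_steps_marginal:
  assumes U: "uniform_steps M n L J" and "k \<in> {1..L}" "i < n"
  shows "\<P>(\<omega> in M. J k \<omega> = i) = 1 / n"
proof -
  have "1 \<le> k" "k \<le> L" using assms by auto
  then show ?thesis using \<open>i < n\<close>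
  proof (induction k arbitrary: i rule: dec_induct)
    case base
    then show ?case using U unfolding uniform_steps_def by blast
  next
    case (step k)
    have Jk: "{\<omega> \<in> space M. J k \<omega> = a} \<in> events" for a
      using U step.hyps step.prems by (intro uniform_steps_sets) auto
    have JS: "{\<omega> \<in> space M. J (Suc k) \<omega> = a} \<in> events" for a
      using U step.hyps step.prems by (intro uniform_steps_sets) auto
    have "\<P>(\<omega> in M. J (Suc k) \<omega> = i) = (\<Sum>a<n. \<P>(\<omega> in M. J k \<omega> = a \<and> J (Suc k) \<omega> = i))"
    proof (rule prob_sum)
      show "AE \<omega> in M. (\<forall>a\<in>{..<n}. J k \<omega> = a \<and> J (Suc k) \<omega> = i \<longrightarrow> J (Suc k) \<omega> = i) \<and>
          (J (Suc k) \<omega> = i \<longrightarrow> (\<exists>!a\<in>{..<n}. J k \<omega> = a \<and> J (Suc k) \<omega> = i))"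
        using step.hyps step.prems uniform_steps_less[OF U, of k] by (intro AE_I2) auto
      show "{\<omega> \<in> space M. J k \<omega> = a \<and> J (Suc k) \<omega> = i} \<in> events" for a
        by (intro sets.sets_Collect_conj Jk JS)
    qed (use JS in auto)
    also have "\<dots> = (\<Sum>a<n. 1 / n / n)"
      using step by (intro sum.cong refl) (simp add: uniform_steps_Suc[OF U])
    also have "\<dots> = 1 / n" using step.prems by simp
    finally show ?case .
  qed
qed

lemma expected_slot_gap:
  assumes U: "uniform_steps M n L J" and k: "k \<in> {1..<L}" and pl: "placement P n slot"
    and n: "n \<ge> 1"
  shows "(\<integral>\<^sup>+ \<omega>. ennreal (slot_gap P (slot (J k \<omega>)) (slot (J (Suc k) \<omega>))) \<partial>M)
    = ennreal (P / 2 * (1 - 1 / n))"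
proof -
  let ?D = "\<lambda>a b. slot_gap P (slot a) (slot b)"
  let ?S = "\<lambda>a b. {\<omega> \<in> space M. J k \<omega> = a \<and> J (Suc k) \<omega> = b}"
  have S: "?S a b \<in> events" for a b
    using U k by (intro sets.sets_Collect_conj uniform_steps_sets) auto
  have pS: "prob (?S a b) = 1 / n / n" if "a < n" "b < n" for a b
    using k that by (simp add: uniform_steps_Suc[OF U k] uniform_steps_marginal[OF U])
  \<comment> \<open>The gap is written as a simple function on the events \<open>?S a b\<close>; at
    each outcome only the term of the actual index pair survives.\<close>
  have "ennreal (?D (J k \<omega>) (J (Suc k) \<omega>))
      = (\<Sum>(a, b)\<in>{..<n} \<times> {..<n}. ennreal (?D a b) * indicator (?S a b) \<omega>)"
    if "\<omega> \<in> space M" for \<omega>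
  proof -
    have "(\<Sum>(a, b)\<in>{..<n} \<times> {..<n}. ennreal (?D a b) * indicator (?S a b) \<omega>)
        = (\<Sum>(a, b)\<in>{(J k \<omega>, J (Suc k) \<omega>)}. ennreal (?D a b) * indicator (?S a b) \<omega>)"
      using k that uniform_steps_less[OF U, of k] uniform_steps_less[OF U, of "Suc k"]
      by (intro sum.mono_neutral_right) (auto simp: indicator_def)
    with that show ?thesis by simp
  qed
  then have "(\<integral>\<^sup>+ \<omega>. ennreal (?D (J k \<omega>) (J (Suc k) \<omega>)) \<partial>M)
      = (\<integral>\<^sup>+ \<omega>. (\<Sum>(a, b)\<in>{..<n} \<times> {..<n}. ennreal (?D a b) * indicator (?S a b) \<omega>) \<partial>M)"
    by (intro nn_integral_cong)
  also have "\<dots> = (\<Sum>(a, b)\<in>{..<n} \<times> {..<n}. ennreal (?D a b) * emeasure M (?S a b))"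
    unfolding case_prod_beta
    by (subst nn_integral_sum) (auto intro!: sum.cong nn_integral_cmult_indicator S borel_measurable_times_ennreal borel_measurable_indicator)
  also have "\<dots> = (\<Sum>(a, b)\<in>{..<n} \<times> {..<n}. ennreal (?D a b * (1 / n / n)))"
    by (intro sum.cong refl) (auto simp: emeasure_eq_measure pS simp flip: ennreal_mult)
  also have "\<dots> = ennreal (\<Sum>(a, b)\<in>{..<n} \<times> {..<n}. ?D a b * (1 / n / n))"
    unfolding case_prod_beta by (intro sum_ennreal) simp
  also have "(\<Sum>(a, b)\<in>{..<n} \<times> {..<n}. ?D a b * (1 / n / n))
      = real (\<Sum>a<n. \<Sum>b<n. ?D a b) * (1 / n / n)"
    by (simp add: sum.cartesian_product[symmetric] sum_distrib_right sum_divide_distrib)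
  also have "real (\<Sum>a<n. \<Sum>b<n. ?D a b) = n * (real n - 1) * P / 2"
  proof -
    \<comment> \<open>The identity is doubled to stay free of division in the naturals;
      \<open>n\<close> \<ge> 1 then turns the truncated \<open>n - 1\<close> into a real
      difference.\<close>
    have "2 * real (\<Sum>a<n. \<Sum>b<n. ?D a b) = real (n * (n - 1) * P)"
      unfolding sum_slot_gap[OF pl, symmetric] by simp
    then show ?thesis using n by (simp add: of_nat_diff)
  qed
  also have "n * (real n - 1) * P / 2 * (1 / n / n) = P / 2 * (1 - 1 / n)"
    using n by (simp add: field_simps)
  finally show ?thesis .
qed

end

section \<open>Summation over the steps of the chase\<close>

theorem theorem6:
  fixes M :: "'w measure"
    and P n L q :: nat
    and slot :: "nat \<Rightarrow> nat"
    and R :: "nat \<Rightarrow> 'v"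
    and f :: "nat \<Rightarrow> 'w \<Rightarrow> 'v \<Rightarrow> nat"
    and J t :: "nat \<Rightarrow> 'w \<Rightarrow> nat"
  assumes "prob_space M"
    and "n \<ge> 1" and "L \<ge> 1" and "q < P"
    and "placement P n slot"
    and "uniform_steps M n L J"
    and "\<And>\<omega>. \<omega> \<in> space M \<Longrightarrow> chase L R (\<lambda>k. f k \<omega>) (\<lambda>k. J k \<omega>)"
    and "\<And>k. k \<in> {1..L} \<Longrightarrow> t k \<in> measurable M (count_space UNIV)"
    and "\<And>\<omega>. \<omega> \<in> space M \<Longrightarrow> read_schedule P q slot L (\<lambda>k. J k \<omega>) (\<lambda>k. t k \<omega>)"
  shows "(\<integral>\<^sup>+ \<omega>. ennreal (real (chase_time L (\<lambda>k. t k \<omega>))) \<partial>M)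
           \<ge> ennreal ((real L - 1) * (real P / 2) * (1 - 1 / real n))"
proof -
  interpret prob_space M by fact
  let ?G = "\<lambda>k \<omega>. slot_gap P (slot (J k \<omega>)) (slot (J (Suc k) \<omega>))"
  have U: "uniform_steps M n L J" by fact
  have meas: "(\<lambda>\<omega>. ennreal (?G k \<omega>)) \<in> borel_measurable M" if "k \<in> {1..<L}" for k
  proof -
    have J: "J k \<in> measurable M (count_space {..<n})" "J (Suc k) \<in> measurable M (count_space {..<n})"
      using U that unfolding uniform_steps_def by auto
    have "(\<lambda>\<omega>. ennreal (slot_gap P (slot a) (slot (J (Suc k) \<omega>)))) \<in> borel_measurable M" for a
      by (rule measurable_compose[OF J(2)]) simp
    then show ?thesis
      by (rule measurable_compose_countable'[OF _ J(1)]) simp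
  qed
  have "ennreal ((real L - 1) * (real P / 2) * (1 - 1 / real n))
      = (\<Sum>k\<in>{1..<L}. ennreal (P / 2 * (1 - 1 / n)))"
  proof -
    \<comment> \<open>Nonnegativity lets \<open>ennreal\<close> commute with the sum, which has
      \<open>L - 1\<close> equal terms.\<close>
    have "0 \<le> P / 2 * (1 - 1 / n)" using assms(2) by (intro mult_nonneg_nonneg) auto
    then have "(\<Sum>k\<in>{1..<L}. ennreal (P / 2 * (1 - 1 / n)))
        = ennreal (\<Sum>k\<in>{1..<L}. P / 2 * (1 - 1 / n))"
      by (intro sum_ennreal)
    then show ?thesis using assms(3) by (simp add: of_nat_diff mult.assoc)
  qed
  also have "\<dots> = (\<Sum>k\<in>{1..<L}. \<integral>\<^sup>+ \<omega>. ennreal (?G k \<omega>) \<partial>M)"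
    using assms(2,5) by (intro sum.cong refl expected_slot_gap[OF U, symmetric])
  also have "\<dots> = (\<integral>\<^sup>+ \<omega>. (\<Sum>k\<in>{1..<L}. ennreal (?G k \<omega>)) \<partial>M)"
    using meas by (intro nn_integral_sum[symmetric])
  \<comment> \<open>The comparison holds outcome by outcome, so it also covers mechanisms whose read
    times use future indices or extra randomness.\<close>
  also have "\<dots> \<le> (\<integral>\<^sup>+ \<omega>. ennreal (real (chase_time L (\<lambda>k. t k \<omega>))) \<partial>M)"
  proof (rule nn_integral_mono)
    fix \<omega> assume "\<omega> \<in> space M"
    then have "(\<Sum>k\<in>{1..<L}. ?G k \<omega>) \<le> chase_time L (\<lambda>k. t k \<omega>)"
      using assms(3,9) by (intro sum_slot_gap_le_chase_time) auto
    then show "(\<Sum>k\<in>{1..<L}. ennreal (?G k \<omega>)) \<le> ennreal (real (chase_time L (\<lambda>k. t k \<omega>)))"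
      by (simp flip: of_nat_sum add: sum_ennreal ennreal_leI)
  qed
  finally show ?thesis .
qed

end
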